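(* For every integer $k\ge 29$, $\Gamma_{\rho}(P_k)=7$, where $P_k$ is the path on $k$ vertices.
   Context: $d(u,v)$ is graph distance. A packing coloring $c:V(G)\to\{1,\dots,k\}$ satisfies: $c(u)=c(v)=i$, $u\ne v$, implies $d(u,v)>i$. The Grundy packing chromatic number $\Gamma_{\rho}(G)$ is the maximum number of colors $k$ in a packing coloring $c:V(G)\to\{1,\dots,k\}$ using all $k$ colors in which every vertex $v$ with $c(v)=i$ has, for every $j\in\{1,\dots,i-1\}$, a vertex $u$ with $c(u)=j$ and $d(u,v)\le j$ (equivalently, the maximum number of colors produced by the greedy procedure that processes vertices in some order and assigns each vertex the smallest color $i$ with no already-colored vertex of color $i$ at distance at most $i$). *)

theory Defs
  imports "Graph_Theory.Graph_Theory"
begin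

text \<open>
  An undirected graph is a symmetric digraph, as in the locale \<open>graph\<close>. The graph distance is the
  shortest-path distance for unit weights; it is \<open>\<infinity>\<close> for vertices in different components.
\<close>

definition gdist :: "('a, 'b) pre_digraph \<Rightarrow> 'a \<Rightarrow> 'a \<Rightarrow> ereal" where
  "gdist G u v = wf_digraph.\<mu> G (\<lambda>_. 1) u v"

definition packing_coloring :: "('a, 'b) pre_digraph \<Rightarrow> nat \<Rightarrow> ('a \<Rightarrow> nat) \<Rightarrow> bool" where
  "packing_coloring G k c \<longleftrightarrow>
     c \<in> verts G \<rightarrow> {1..k} \<and>
     (\<forall>u\<in>verts G. \<forall>v\<in>verts G. \<forall>i. c u = i \<and> c v = i \<and> u \<noteq> v \<longrightarrow> gdist G u v > ereal (real i))"

definition grundy_packing_coloring :: "('a, 'b) pre_digraph \<Rightarrow> nat \<Rightarrow> ('a \<Rightarrow> nat) \<Rightarrow> bool" where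
  "grundy_packing_coloring G k c \<longleftrightarrow>
     packing_coloring G k c \<and>
     c ` verts G = {1..k} \<and>
     (\<forall>v\<in>verts G. \<forall>j\<in>{1..<c v}. \<exists>u\<in>verts G. c u = j \<and> gdist G u v \<le> ereal (real j))"

definition grundy_packing_chromatic_number :: "('a, 'b) pre_digraph \<Rightarrow> nat" where
  "grundy_packing_chromatic_number G = Max {k. \<exists>c. grundy_packing_coloring G k c}"

definition path_graph :: "nat \<Rightarrow> nat pair_pre_digraph" where
  "path_graph k =
     \<lparr> pverts = {1..k},
       parcs = {(i, j). i \<in> {1..k} \<and> j \<in> {1..k} \<and> (j = Suc i \<or> i = Suc j)} \<rparr>"

lemma pair_graph_path_graph: "pair_graph (path_graph k)"
proof
  have "parcs (path_graph k) \<subseteq> {1..k} \<times> {1..k}"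
    by (auto simp: path_graph_def)
  then show "finite (parcs (path_graph k))"
    by (rule finite_subset) simp
qed (auto simp: path_graph_def symmetric_def sym_def)

lemma finite_grundy_packing_colorings:
  assumes "finite (verts G)"
  shows "finite {k. \<exists>c. grundy_packing_coloring G k c}"
proof (rule finite_subset)
  show "{k. \<exists>c. grundy_packing_coloring G k c} \<subseteq> {..card (verts G)}"
  proof (intro subsetI, elim CollectE exE)
    fix k c assume "grundy_packing_coloring G k c"
    then have "c ` verts G = {1..k}"
      by (simp add: grundy_packing_coloring_def)
    then have "k = card (c ` verts G)"
      by simp
    then show "k \<in> {..card (verts G)}"
      using card_image_le[OF assms, of c] by simp
  qed
qed simp

end

theory Submission
  imports Defs
begin

text \<open>
  Greediness makes every finite Grundy packing colouring extend to any finite set of further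
  vertices. Hence a colouring of 29 consecutive integers with 7 colours yields one with at least
  7 colours on every longer path. Conversely, the neighbourhood of a vertex of colour at least 8 may
  be assumed to be fully coloured; growing the word of colours around that vertex alternately at its
  two ends always runs into a violated distance or greediness condition within 18 steps.
\<close>

section \<open>Grundy packing colourings with respect to a distance\<close>

definition grundy_packing_on :: "('a \<Rightarrow> 'a \<Rightarrow> ereal) \<Rightarrow> 'a set \<Rightarrow> ('a \<Rightarrow> nat) \<Rightarrow> bool" where
  "grundy_packing_on d S c \<longleftrightarrow>
     (\<forall>v\<in>S. 1 \<le> c v) \<and>
     (\<forall>u\<in>S. \<forall>v\<in>S. u \<noteq> v \<and> c u = c v \<longrightarrow> ereal (real (c u)) < d u v) \<and>
     (\<forall>v\<in>S. \<forall>j\<in>{1..<c v}. \<exists>u\<in>S. c u = j \<and> d u v \<le> ereal (real j))"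

lemma
  assumes "grundy_packing_on d S c"
  shows grundy_packing_on_pos: "v \<in> S \<Longrightarrow> 1 \<le> c v"
    and grundy_packing_on_less_dist:
      "u \<in> S \<Longrightarrow> v \<in> S \<Longrightarrow> u \<noteq> v \<Longrightarrow> c u = c v \<Longrightarrow> ereal (real (c u)) < d u v"
    and grundy_packing_on_ex_dist_le:
      "v \<in> S \<Longrightarrow> 1 \<le> j \<Longrightarrow> j < c v \<Longrightarrow> \<exists>u\<in>S. c u = j \<and> d u v \<le> ereal (real j)"
  using assms unfolding grundy_packing_on_def by simp_all

lemma grundy_packing_coloring_iff:
  "grundy_packing_coloring G k c \<longleftrightarrow>
     grundy_packing_on (gdist G) (verts G) c \<and> c ` verts G = {1..k}"
  unfolding grundy_packing_coloring_def packing_coloring_def grundy_packing_on_def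
  by (auto simp: Pi_iff; metis)

lemma grundy_packing_on_cong:
  assumes "\<And>u v. u \<in> S \<Longrightarrow> v \<in> S \<Longrightarrow> d u v = d' u v"
  shows "grundy_packing_on d S c \<longleftrightarrow> grundy_packing_on d' S c"
  using assms unfolding grundy_packing_on_def by (simp cong: bex_cong)

lemma grundy_packing_on_image:
  assumes "inj_on h S"
  shows "grundy_packing_on d (h ` S) c \<longleftrightarrow>
    grundy_packing_on (\<lambda>u v. d (h u) (h v)) S (c \<circ> h)"
  using assms unfolding grundy_packing_on_def by (auto simp: inj_on_eq_iff)

lemma grundy_packing_on_image_eq_atLeastAtMost:
  assumes "finite S" "grundy_packing_on d S c"
  shows "\<exists>m. c ` S = {1..m}"
proof
  define m where "m = Max (insert 0 (c ` S))"
  have "c v \<in> {1..m}" if "v \<in> S" for v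
    using grundy_packing_on_pos[OF assms(2) that] assms(1) that by (simp add: m_def)
  moreover have "j \<in> c ` S" if "j \<in> {1..m}" for j
  proof -
    have "m \<in> insert 0 (c ` S)"
      unfolding m_def using assms(1) by (intro Max_in) auto
    moreover have "m \<noteq> 0"
      using that by auto
    ultimately obtain v where "v \<in> S" "c v = m"
      by auto
    then show ?thesis
      using grundy_packing_on_ex_dist_le[OF assms(2), of v j] that by (cases "j = m") auto
  qed
  ultimately show "c ` S = {1..m}"
    by blast
qed

lemma grundy_packing_on_insert:
  assumes coloring: "grundy_packing_on d S c"
    and x_notin: "x \<notin> S"
    and dist_commute: "\<And>u v. d u v = d v u"
    and i_pos: "1 \<le> i"
    and i_free: "\<And>u. u \<in> S \<Longrightarrow> c u = i \<Longrightarrow> ereal (real i) < d u x"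
    and i_greedy: "\<And>j. 1 \<le> j \<Longrightarrow> j < i \<Longrightarrow> \<exists>u\<in>S. c u = j \<and> d u x \<le> ereal (real j)"
  shows "grundy_packing_on d (insert x S) (c(x := i))"
proof -
  define c' where "c' = c(x := i)"
  have c'_old: "c' u = c u" if "u \<in> S" for u
    using that x_notin by (auto simp: c'_def)
  have c'_new: "c' x = i"
    by (simp add: c'_def)
  have "grundy_packing_on d (insert x S) c'"
    unfolding grundy_packing_on_def
  proof (intro conjI ballI impI)
    show "1 \<le> c' v" if "v \<in> insert x S" for v
      using that i_pos grundy_packing_on_pos[OF coloring, of v] by (auto simp: c'_old c'_new)
  next
    fix u v
    assume "u \<in> insert x S" "v \<in> insert x S" and same_color: "u \<noteq> v \<and> c' u = c' v"
    then consider "u \<in> S" "v \<in> S" | "u = x" "v \<in> S" | "u \<in> S" "v = x"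
      by blast
    then show "ereal (real (c' u)) < d u v"
      using same_color grundy_packing_on_less_dist[OF coloring, of u v] i_free
      by cases (auto simp: c'_old c'_new dist_commute[of x])
  next
    fix v j
    assume "v \<in> insert x S" "j \<in> {1..<c' v}"
    then have "\<exists>u\<in>S. c u = j \<and> d u v \<le> ereal (real j)"
      using i_greedy grundy_packing_on_ex_dist_le[OF coloring, of v j]
      by (cases "v = x") (auto simp: c'_old c'_new)
    then show "\<exists>u\<in>insert x S. c' u = j \<and> d u v \<le> ereal (real j)"
      using c'_old by auto
  qed
  then show ?thesis
    by (simp only: c'_def)
qed

lemma ex_grundy_packing_on_insert:
  assumes "finite S" "grundy_packing_on d S c" "x \<notin> S" "\<And>u v. d u v = d v u"
  shows "\<exists>i. grundy_packing_on d (insert x S) (c(x := i))"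
proof -
  define free where "free i \<longleftrightarrow> 1 \<le> i \<and> (\<forall>u\<in>S. c u = i \<longrightarrow> ereal (real i) < d u x)" for i
  define i where "i = (LEAST i. free i)"
  obtain unused where "unused \<notin> insert 0 (c ` S)"
    using ex_new_if_finite[OF infinite_UNIV_nat, of "insert 0 (c ` S)"] assms(1) by auto
  then have "free unused"
    by (auto simp: free_def)
  then have i_free: "free i" and i_least: "\<And>j. j < i \<Longrightarrow> \<not> free j"
    unfolding i_def by (blast intro: LeastI dest: not_less_Least)+
  have "\<exists>u\<in>S. c u = j \<and> d u x \<le> ereal (real j)" if "1 \<le> j" "j < i" for j
    using i_least[OF that(2)] that(1) by (auto simp: free_def not_less)
  then have "grundy_packing_on d (insert x S) (c(x := i))"
    using assms(2-4) i_free by (intro grundy_packing_on_insert) (auto simp: free_def)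
  then show ?thesis ..
qed

lemma grundy_packing_on_extend:
  assumes "finite T" "S \<subseteq> T" "grundy_packing_on d S c" "\<And>u v. d u v = d v u"
  shows "\<exists>c'. grundy_packing_on d T c' \<and> (\<forall>v\<in>S. c' v = c v)"
proof -
  have "finite S"
    using assms(1,2) by (rule rev_finite_subset)
  have "\<exists>c'. grundy_packing_on d (S \<union> R) c' \<and> (\<forall>v\<in>S. c' v = c v)"
    if "finite R" "S \<inter> R = {}" for R
    using that
  proof (induction R rule: finite_induct)
    case empty
    then show ?case using assms(3) by auto
  next
    case (insert x R)
    then obtain c' where c': "grundy_packing_on d (S \<union> R) c'" "\<forall>v\<in>S. c' v = c v"
      by blast
    obtain i where "grundy_packing_on d (insert x (S \<union> R)) (c'(x := i))"
      using ex_grundy_packing_on_insert[OF _ c'(1) _ assms(4), of x] \<open>finite S\<close> insert by auto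
    moreover have "(c'(x := i)) v = c v" if "v \<in> S" for v
      using that c'(2) insert.prems by auto
    ultimately show ?case
      by auto
  qed
  from this[of "T - S"] show ?thesis
    using assms(1,2) by (simp add: Un_absorb1)
qed

section \<open>Distance in paths\<close>

definition line_dist :: "int \<Rightarrow> int \<Rightarrow> ereal" where
  "line_dist u v = ereal (real_of_int \<bar>u - v\<bar>)"

lemma line_dist_le_iff [simp]: "line_dist u v \<le> ereal (real i) \<longleftrightarrow> \<bar>u - v\<bar> \<le> int i"
  unfolding line_dist_def ereal_less_eq by linarith

lemma less_line_dist_iff [simp]: "ereal (real i) < line_dist u v \<longleftrightarrow> int i < \<bar>u - v\<bar>"
  unfolding line_dist_def less_ereal.simps by linarith

lemma line_dist_commute: "line_dist u v = line_dist v u"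
  by (simp add: line_dist_def abs_minus_commute)

context wf_digraph
begin

lemma awalk_cost_1: "awalk_cost (\<lambda>_. 1) p = real (length p)"
  by (simp add: awalk_cost_def sum_list_triv)

lemma Lipschitz_le_awalk_length:
  fixes f :: "'a \<Rightarrow> real"
  assumes "\<And>e. e \<in> arcs G \<Longrightarrow> \<bar>f (tail G e) - f (head G e)\<bar> \<le> 1"
    and "awalk u p v"
  shows "\<bar>f u - f v\<bar> \<le> real (length p)"
  using assms(2)
proof (induction p arbitrary: u)
  case Nil
  then show ?case by (simp add: awalk_Nil_iff)
next
  case (Cons e p)
  then have "\<bar>f u - f (head G e)\<bar> \<le> 1" "\<bar>f (head G e) - f v\<bar> \<le> real (length p)"
    using assms(1) by (auto simp: awalk_Cons_iff)
  then show ?case by simp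
qed

lemma Lipschitz_le_gdist:
  fixes f :: "'a \<Rightarrow> real"
  assumes "\<And>e. e \<in> arcs G \<Longrightarrow> \<bar>f (tail G e) - f (head G e)\<bar> \<le> 1"
  shows "ereal \<bar>f u - f v\<bar> \<le> gdist G u v"
  unfolding gdist_def \<mu>_def
  by (rule INF_greatest) (simp add: awalk_cost_1 Lipschitz_le_awalk_length[OF assms])

lemma gdist_self_le: "u \<in> verts G \<Longrightarrow> gdist G u u \<le> 0"
  unfolding gdist_def
  using min_cost_le_walk_cost[of u "[]" u "\<lambda>_. 1"] by (simp add: awalk_Nil_iff zero_ereal_def)

end

lemma gdist_path_graph:
  assumes "u \<in> {1..n}" "v \<in> {1..n}"
  shows "gdist (with_proj (path_graph n)) u v = line_dist (int u) (int v)"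
proof (rule antisym)
  interpret pair_graph "path_graph n" by (rule pair_graph_path_graph)
  show "gdist (with_proj (path_graph n)) u v \<le> line_dist (int u) (int v)"
    using assms(2)
  proof (induction "nat \<bar>int u - int v\<bar>" arbitrary: v)
    case 0
    then show ?case
      using assms(1) gdist_self_le[of u]
      by (simp add: line_dist_def path_graph_def zero_ereal_def)
  next
    case (Suc d)
    define v' where "v' = (if v < u then v + 1 else v - 1)"
    have v': "d = nat \<bar>int u - int v'\<bar>" "v' \<in> {1..n}" "\<bar>int u - int v\<bar> = \<bar>int u - int v'\<bar> + 1"
      and arc: "(v', v) \<in> parcs (path_graph n)"
      using Suc.hyps(2) Suc.prems assms(1) by (auto simp: v'_def path_graph_def split: if_splits)
    have "gdist (with_proj (path_graph n)) u v \<le> gdist (with_proj (path_graph n)) u v' + 1"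
      unfolding gdist_def
      using pos_cost_mu_triangle[of "\<lambda>_. 1" "(v', v)" v' v u] arc
      by (simp add: arc_to_ends_def one_ereal_def)
    also have "\<dots> \<le> line_dist (int u) (int v') + 1"
      using Suc.hyps(1)[OF v'(1,2)] by (rule add_right_mono)
    also have "\<dots> = line_dist (int u) (int v)"
      using v'(3) by (simp add: line_dist_def one_ereal_def)
    finally show ?case .
  qed
  have "\<bar>real (fst e) - real (snd e)\<bar> \<le> 1" if "e \<in> parcs (path_graph n)" for e
    using that by (auto simp: path_graph_def)
  then show "line_dist (int u) (int v) \<le> gdist (with_proj (path_graph n)) u v"
    using Lipschitz_le_gdist[of real u v] by (simp add: line_dist_def)
qed

lemma grundy_packing_coloring_path_graph_iff:
  "grundy_packing_coloring (with_proj (path_graph n)) k (c \<circ> int) \<longleftrightarrow>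
     grundy_packing_on line_dist {1..int n} c \<and> c ` {1..int n} = {1..k}"
proof -
  have "{1..int n} = int ` {1..n}"
    by (simp add: image_int_atLeastAtMost)
  moreover have "grundy_packing_on (gdist (with_proj (path_graph n))) {1..n} (c \<circ> int) \<longleftrightarrow>
      grundy_packing_on (\<lambda>u v. line_dist (int u) (int v)) {1..n} (c \<circ> int)"
    by (intro grundy_packing_on_cong gdist_path_graph)
  moreover have "verts (with_proj (path_graph n)) = {1..n}"
    by (simp add: path_graph_def)
  ultimately show ?thesis
    by (simp only: grundy_packing_coloring_iff grundy_packing_on_image inj_on_of_nat image_comp)
qed

section \<open>Words of colours occurring on the line\<close>

text \<open>The letter \<^term>\<open>m\<close> stands for all colours that are at least \<^term>\<open>m\<close>.\<close>

definition occurs :: "nat \<Rightarrow> nat list \<Rightarrow> bool" where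
  "occurs m w \<longleftrightarrow>
     (\<exists>S c p. finite S \<and> grundy_packing_on line_dist S c \<and>
       (\<forall>i<length w. p + int i \<in> S \<and> w ! i = min m (c (p + int i))))"

lemma occursE:
  assumes "occurs m w"
  obtains S c p where "finite S" "grundy_packing_on line_dist S c"
    and "\<And>i. i < length w \<Longrightarrow> p + int i \<in> S"
    and "\<And>i. i < length w \<Longrightarrow> w ! i = min m (c (p + int i))"
  using assms unfolding occurs_def by blast

lemma occursI:
  assumes "finite S" "grundy_packing_on line_dist S c"
    and "\<And>i. i < length w \<Longrightarrow> p + int i \<in> S"
    and "\<And>i. i < length w \<Longrightarrow> w ! i = min m (c (p + int i))"
  shows "occurs m w"
  using assms unfolding occurs_def by blast

lemma grundy_packing_on_line_dist_uminus:
  assumes "grundy_packing_on line_dist S c"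
  shows "grundy_packing_on line_dist (uminus ` S) (c \<circ> uminus)"
proof -
  have "(\<lambda>u v. line_dist (- u) (- v)) = line_dist"
    by (simp add: line_dist_def fun_eq_iff abs_minus_commute)
  then show ?thesis
    using assms by (simp add: grundy_packing_on_image comp_assoc)
qed

lemma occurs_rev:
  assumes "occurs m w"
  shows "occurs m (rev w)"
  using assms
proof (rule occursE)
  fix S c p
  assume finite_S: "finite S" and coloring: "grundy_packing_on line_dist S c"
    and in_S: "\<And>i. i < length w \<Longrightarrow> p + int i \<in> S"
    and nth_w: "\<And>i. i < length w \<Longrightarrow> w ! i = min m (c (p + int i))"
  define q where "q = - (p + int (length w - 1))"
  have q_plus: "q + int i = - (p + int (length w - Suc i))" if "i < length w" for i
    using that by (simp add: q_def)
  show ?thesis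
  proof (rule occursI)
    show "finite (uminus ` S)"
      using finite_S by simp
    show "grundy_packing_on line_dist (uminus ` S) (c \<circ> uminus)"
      using coloring by (rule grundy_packing_on_line_dist_uminus)
    fix i assume "i < length (rev w)"
    then have i: "i < length w"
      by simp
    show "q + int i \<in> uminus ` S"
      unfolding q_plus[OF i] using i by (intro imageI in_S) simp
    show "rev w ! i = min m ((c \<circ> uminus) (q + int i))"
      unfolding q_plus[OF i] comp_apply minus_minus using i by (simp add: rev_nth nth_w)
  qed
qed

lemma ex_occurs_Cons:
  assumes "occurs m w"
  shows "\<exists>a. occurs m (a # w)"
  using assms
proof (rule occursE)
  fix S c p
  assume finite_S: "finite S" and coloring: "grundy_packing_on line_dist S c"
    and in_S: "\<And>i. i < length w \<Longrightarrow> p + int i \<in> S"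
    and nth_w: "\<And>i. i < length w \<Longrightarrow> w ! i = min m (c (p + int i))"
  obtain c' where c': "grundy_packing_on line_dist (insert (p - 1) S) c'" "\<And>v. v \<in> S \<Longrightarrow> c' v = c v"
    using grundy_packing_on_extend[OF _ subset_insertI coloring line_dist_commute] finite_S
    by (metis finite_insert)
  have "occurs m (min m (c' (p - 1)) # w)"
    using finite_S c'(1)
  proof (rule occursI[OF finite.insertI])
    fix i assume "i < length (min m (c' (p - 1)) # w)"
    then show "p - 1 + int i \<in> insert (p - 1) S"
      and "(min m (c' (p - 1)) # w) ! i = min m (c' (p - 1 + int i))"
      using in_S[of "i - 1"] nth_w[of "i - 1"] c'(2) by (cases i; simp)+
  qed
  then show ?thesis ..
qed

text \<open>
  In \<^term>\<open>a # w\<close> the positions within distance \<^term>\<open>j\<close> of position \<^term>\<open>j\<close> are the first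
  \<^term>\<open>2 * j + 1\<close> ones, so if \<^term>\<open>j\<close> is missing among the first \<^term>\<open>2 * j\<close> letters of \<^term>\<open>w\<close>,
  then a larger letter at position \<^term>\<open>j\<close> leaves no choice but \<^term>\<open>a = j\<close>.
\<close>

definition forced :: "nat \<Rightarrow> nat list \<Rightarrow> nat list" where
  "forced m w =
     filter (\<lambda>j. 2 * j \<le> length w \<and> j < w ! (j - 1) \<and> j \<notin> set (take (2 * j) w)) [1..<m]"

text \<open>With the fold, symbolic evaluation computes the forced letters only once.\<close>

definition candidates :: "nat \<Rightarrow> nat list \<Rightarrow> nat list" where
  "candidates m w =
     filter (\<lambda>a. a = m \<or> a \<notin> set (take a w)) (fold (\<lambda>j. filter ((=) j)) (forced m w) [1..<Suc m])"

lemma set_fold_filter: "set (fold (\<lambda>j. filter (P j)) js xs) = {x \<in> set xs. \<forall>j\<in>set js. P j x}"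
  by (induction js arbitrary: xs) auto

lemma occurs_Cons_forced:
  assumes "occurs m (a # w)" "j \<in> set (forced m w)"
  shows "a = j"
  using assms(1)
proof (rule occursE)
  fix S c p
  assume coloring: "grundy_packing_on line_dist S c"
    and in_S: "\<And>i. i < length (a # w) \<Longrightarrow> p + int i \<in> S"
    and nth_w: "\<And>i. i < length (a # w) \<Longrightarrow> (a # w) ! i = min m (c (p + int i))"
  have j_missing: "1 \<le> j" "j < m" "2 * j \<le> length w" "j < w ! (j - 1)" "j \<notin> set (take (2 * j) w)"
    using assms(2) by (auto simp: forced_def)
  then have "j < c (p + int j)"
    using nth_w[of j] by (simp add: nth_Cons')
  then obtain u where u: "c u = j" "\<bar>u - (p + int j)\<bar> \<le> int j"
    using grundy_packing_on_ex_dist_le[OF coloring in_S, of j j] j_missing by auto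
  define i where "i = nat (u - p)"
  have i: "u = p + int i" "i \<le> 2 * j"
    using u(2) by (auto simp: i_def)
  then have nth_i: "(a # w) ! i = j"
    using nth_w[of i] u(1) j_missing by simp
  show "a = j"
  proof (cases i)
    case 0
    then show ?thesis using nth_i by simp
  next
    case (Suc i')
    then have "j = take (2 * j) w ! i'" "i' < length (take (2 * j) w)"
      using nth_i i j_missing by auto
    then show ?thesis
      using j_missing(5) by (metis nth_mem)
  qed
qed

lemma occurs_Cons_notin_take:
  assumes "occurs m (a # w)" "a \<noteq> m"
  shows "a \<notin> set (take a w)"
  using assms(1)
proof (rule occursE, intro notI)
  fix S c p
  assume coloring: "grundy_packing_on line_dist S c"
    and in_S: "\<And>i. i < length (a # w) \<Longrightarrow> p + int i \<in> S"
    and nth_w: "\<And>i. i < length (a # w) \<Longrightarrow> (a # w) ! i = min m (c (p + int i))"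
  assume "a \<in> set (take a w)"
  then obtain i where i: "i < a" "i < length w" "w ! i = a"
    by (auto simp: in_set_conv_nth)
  then have "c p = a" "c (p + int (Suc i)) = a"
    using nth_w[of 0] nth_w[of "Suc i"] assms(2) by (auto simp: min_def split: if_splits)
  then have "int a < int (Suc i)"
    using grundy_packing_on_less_dist[OF coloring, of p "p + int (Suc i)"] in_S[of 0] in_S[of "Suc i"] i
    by simp
  then show False
    using i(1) by simp
qed

lemma occurs_Cons_in_atLeastAtMost:
  assumes "occurs m (a # w)" "0 < m"
  shows "a \<in> {1..m}"
  using assms(1)
proof (rule occursE)
  fix S c p
  assume "grundy_packing_on line_dist S c"
    and "\<And>i. i < length (a # w) \<Longrightarrow> p + int i \<in> S"
    and "\<And>i. i < length (a # w) \<Longrightarrow> (a # w) ! i = min m (c (p + int i))"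
  from this(1) this(2,3)[of 0] show ?thesis
    using grundy_packing_on_pos[of line_dist S c p] assms(2) by simp
qed

lemma occurs_Cons_in_candidates:
  assumes "occurs m (a # w)" "0 < m"
  shows "a \<in> set (candidates m w)"
  using occurs_Cons_in_atLeastAtMost[OF assms] occurs_Cons_notin_take[OF assms(1)]
    occurs_Cons_forced[OF assms(1)]
  by (auto simp: candidates_def set_fold_filter simp del: upt_Suc)

text \<open>The reversal makes the word grow alternately at both ends.\<close>

fun refutable :: "nat \<Rightarrow> nat \<Rightarrow> nat list \<Rightarrow> bool" where
  "refutable m 0 w \<longleftrightarrow> False"
| "refutable m (Suc n) w \<longleftrightarrow> (\<forall>a\<in>set (candidates m w). refutable m n (rev (a # w)))"

lemma refutable_imp_not_occurs:
  assumes "0 < m" "refutable m n w"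
  shows "\<not> occurs m w"
  using assms(2)
proof (induction n arbitrary: w)
  case 0
  then show ?case by simp
next
  case (Suc n)
  show ?case
  proof
    assume "occurs m w"
    then obtain a where a: "occurs m (a # w)"
      using ex_occurs_Cons by blast
    then have "refutable m n (rev (a # w))"
      using Suc.prems occurs_Cons_in_candidates[OF a assms(1)] by simp
    then show False
      using Suc.IH occurs_rev[OF a] by blast
  qed
qed

section \<open>The bounds for paths\<close>

lemma refutable_8: "refutable 8 18 [8]"
  by code_simp

lemma grundy_packing_on_line_dist_le_7:
  assumes "finite S" "grundy_packing_on line_dist S c" "v \<in> S"
  shows "c v \<le> 7"
proof (rule ccontr)
  assume "\<not> c v \<le> 7"
  then have "occurs 8 [8]"
    by (intro occursI[OF assms(1,2), of _ v]) (simp_all add: assms(3))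
  then show False
    using refutable_imp_not_occurs[OF _ refutable_8] by simp
qed

lemma ex_grundy_packing_on_line_dist_29:
  "\<exists>c. grundy_packing_on line_dist {1..29} c \<and> c 13 = 7"
proof -
  define c :: "int \<Rightarrow> nat" where
    "c i = [4,1,2,3,1,4,2,1,5,3,1,2,7,1,4,2,1,3,6,1,2,1,5,3,1,2,4,1,2] ! nat (i - 1)" for i
  have pos: "\<forall>v\<in>{1..29}. 1 \<le> c v"
    unfolding c_def by code_simp
  have ordered_packing: "\<forall>v\<in>{1..29}. \<forall>u\<in>{1..<v}. c u = c v \<longrightarrow> int (c u) < \<bar>u - v\<bar>"
    unfolding c_def by code_simp
  have packing: "int (c u) < \<bar>u - v\<bar>"
    if "u \<in> {1..29}" "v \<in> {1..29}" "u \<noteq> v" "c u = c v" for u v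
    using that ordered_packing[rule_format, of v u] ordered_packing[rule_format, of u v]
    by (cases u v rule: linorder_cases) auto
  have greedy: "\<forall>v\<in>{1..29}. \<forall>j\<in>{1..<c v}. \<exists>u\<in>{1..29}. c u = j \<and> \<bar>u - v\<bar> \<le> int j"
    unfolding c_def by code_simp
  have "grundy_packing_on line_dist {1..29} c"
    unfolding grundy_packing_on_def line_dist_le_iff less_line_dist_iff
    using pos packing greedy by blast
  moreover have "c 13 = 7"
    by (simp add: c_def)
  ultimately show ?thesis
    by blast
qed

lemma grundy_packing_coloring_path_graph_le_7:
  assumes "grundy_packing_coloring (with_proj (path_graph n)) k c"
  shows "k \<le> 7"
proof (cases "k = 0")
  case False
  have "grundy_packing_coloring (with_proj (path_graph n)) k ((c \<circ> nat) \<circ> int)"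
    using assms by (simp add: comp_def)
  then have coloring: "grundy_packing_on line_dist {1..int n} (c \<circ> nat)"
    and "(c \<circ> nat) ` {1..int n} = {1..k}"
    unfolding grundy_packing_coloring_path_graph_iff by simp_all
  then obtain v where "v \<in> {1..int n}" "(c \<circ> nat) v = k"
    using False by (metis atLeastAtMost_iff imageE less_one not_less order_refl)
  then show ?thesis
    using grundy_packing_on_line_dist_le_7[OF _ coloring] by auto
qed simp

lemma ex_grundy_packing_coloring_path_graph_ge_7:
  assumes "29 \<le> n"
  shows "\<exists>k\<ge>7. \<exists>c. grundy_packing_coloring (with_proj (path_graph n)) k c"
proof -
  obtain c0 where c0: "grundy_packing_on line_dist {1..29} c0" "c0 13 = 7"
    using ex_grundy_packing_on_line_dist_29 by blast
  have "{1..29} \<subseteq> {1..int n}"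
    using assms by simp
  then obtain c where c: "grundy_packing_on line_dist {1..int n} c" "c 13 = 7"
    using grundy_packing_on_extend[OF _ _ c0(1) line_dist_commute, of "{1..int n}"] c0(2) by auto
  then obtain k where k: "c ` {1..int n} = {1..k}"
    using grundy_packing_on_image_eq_atLeastAtMost by blast
  have "7 \<in> c ` {1..int n}"
    using c(2) assms by (intro image_eqI[of _ _ 13]) simp_all
  then have "7 \<le> k"
    using k by simp
  then show ?thesis
    using c(1) k grundy_packing_coloring_path_graph_iff by blast
qed

theorem theorem22:
  fixes k :: nat
  assumes "k \<ge> 29"
  shows "grundy_packing_chromatic_number (with_proj (path_graph k)) = 7"
  unfolding grundy_packing_chromatic_number_def
proof (rule Max_eqI)
  let ?K = "{m. \<exists>c. grundy_packing_coloring (with_proj (path_graph k)) m c}"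
  show "finite ?K"
    by (rule finite_grundy_packing_colorings) (simp add: path_graph_def)
  show le_7: "m \<le> 7" if "m \<in> ?K" for m
    using that grundy_packing_coloring_path_graph_le_7 by blast
  obtain m where "7 \<le> m" "m \<in> ?K"
    using ex_grundy_packing_coloring_path_graph_ge_7[OF assms] by blast
  with le_7[of m] show "7 \<in> ?K"
    by simp
qed

end
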